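(* There are universal constants $c_0,c,C>0$ such that the following holds. Fix $p\in(0,1)$ and either one of the two models (Lorentz mirror or Manhattan) on $\mathbb Z^2$, with law $\mathbb P_p$. Suppose that for some integer $n_0>100$, $$\mathbb P_p\bigl(\mathrm{Cross}(100n_0,n_0)\bigr)\le c_0.$$ Let $\mathrm{PlaneLoc}_m$ be the event that every trajectory on $\mathbb Z^2$ whose initial vertex lies in $[-1,1]^2$ remains in $[-m,m]^2$. Then $$\mathbb P_p(\mathrm{PlaneLoc}_m)\ge 1-\exp\{-cm/n_0\}\qquad\text{for all } m\ge Cn_0.$$
   Context: Mirrors and trajectories on $\mathbb Z^2$: each vertex has four incident half-edges $N,E,S,W$ (pointing in directions $(0,1),(1,0),(0,-1),(-1,0)$). A one-site state is one of: no mirror, pairing $(N,S)(E,W)$; a north-west (NW) mirror (a diagonal segment along the NW--SE direction), pairing $(N,E)(S,W)$; a north-east (NE) mirror (along the NE--SW direction), pairing $(N,W)(S,E)$. A ray arriving at a vertex along a half-edge leaves along the half-edge paired with it. A directed edge is an ordered pair $(u,v)$ of nearest neighbors; together with the environment (a state at each vertex) it determines a trajectory, i.e. the sequence of directed edges starting with $(u,v)$ and following this rule at each vertex; $u$ is its initial vertex. A trajectory segment is a finite sequence of consecutive directed edges $e_k=(v_{k-1},v_k)$ following the rule at each intermediate vertex. A trajectory remains in a set if all its vertices lie in it. Lorentz mirror model: independently at each vertex, no mirror with probability $1-p$, and a NW or NE mirror with probability $p/2$ each. Manhattan model: independently at each vertex $(x,y)$, a mirror with probability $p$ and no mirror with probability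 $1-p$; a mirror at $(x,y)$ is NW if $x-y$ is even and NE otherwise. Crossing event: for integers $m,h\ge1$ let $R_{m,h}=\{1,\dots,m\}\times\{1,\dots,h\}$. For $1\le i,j\le m$, $\mathrm{Cross}_{i,j}(m,h)$ is the event that there is a trajectory segment which enters $R_{m,h}$ through the directed edge $((i,0),(i,1))$, exits through $((j,h),(j,h+1))$, and has all intermediate vertices in $R_{m,h}$. $\mathrm{Cross}(m,h)=\bigcup_{1\le i,j\le m}\mathrm{Cross}_{i,j}(m,h)$. *)

theory Defs
  imports "HOL-Probability.Probability"
begin

type_synonym vertex = "int \<times> int"

text \<open>A half-edge at a vertex is identified with the direction in which it points.\<close>

datatype direction = North | East | South | West

fun step :: "direction \<Rightarrow> vertex" where
  "step North = (0, 1)"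
| "step East = (1, 0)"
| "step South = (0, -1)"
| "step West = (-1, 0)"

datatype site_state = No_Mirror | NW_Mirror | NE_Mirror

fun partner :: "site_state \<Rightarrow> direction \<Rightarrow> direction" where
  "partner No_Mirror North = South"
| "partner No_Mirror South = North"
| "partner No_Mirror East = West"
| "partner No_Mirror West = East"
| "partner NW_Mirror North = East"
| "partner NW_Mirror East = North"
| "partner NW_Mirror South = West"
| "partner NW_Mirror West = South"
| "partner NE_Mirror North = West"
| "partner NE_Mirror West = North"
| "partner NE_Mirror South = East"
| "partner NE_Mirror East = South"

type_synonym environment = "vertex \<Rightarrow> site_state"

type_synonym edge = "vertex \<times> vertex"

definition directed_edge :: "edge \<Rightarrow> bool" where
  "directed_edge e \<longleftrightarrow> (\<exists>d. snd e = fst e + step d)"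

text \<open>
  The ray on the edge \<open>e = (u, v)\<close> arrives at \<open>v\<close> along the half-edge of \<open>v\<close> that points back
  towards \<open>u\<close>, so \<open>d\<close> below is the direction from \<open>v\<close> to \<open>u\<close>, opposite to the motion.
\<close>

definition follows :: "environment \<Rightarrow> edge \<Rightarrow> edge \<Rightarrow> bool" where
  "follows \<omega> e e' \<longleftrightarrow> fst e' = snd e \<and>
     (\<exists>d. fst e = snd e + step d \<and> snd e' = snd e + step (partner (\<omega> (snd e)) d))"

definition trajectory :: "environment \<Rightarrow> (nat \<Rightarrow> edge) \<Rightarrow> bool" where
  "trajectory \<omega> e \<longleftrightarrow> directed_edge (e 0) \<and> (\<forall>k. follows \<omega> (e k) (e (Suc k)))"

definition remains_in :: "(nat \<Rightarrow> edge) \<Rightarrow> vertex set \<Rightarrow> bool" where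
  "remains_in e A \<longleftrightarrow> (\<forall>k. fst (e k) \<in> A \<and> snd (e k) \<in> A)"

definition trajectory_segment :: "environment \<Rightarrow> edge list \<Rightarrow> bool" where
  "trajectory_segment \<omega> es \<longleftrightarrow>
     es \<noteq> [] \<and> (\<forall>e \<in> set es. directed_edge e) \<and> successively (follows \<omega>) es"

definition intermediate_vertices :: "edge list \<Rightarrow> vertex set" where
  "intermediate_vertices es = snd ` set (butlast es)"

datatype model = Lorentz | Manhattan

fun site_law :: "model \<Rightarrow> real \<Rightarrow> vertex \<Rightarrow> site_state pmf" where
  "site_law Lorentz p v =
     do {
       mirror \<leftarrow> bernoulli_pmf p;
       if mirror then pmf_of_set {NW_Mirror, NE_Mirror} else return_pmf No_Mirror
     }"
| "site_law Manhattan p (x, y) =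
     map_pmf (\<lambda>mirror. if mirror then (if even (x - y) then NW_Mirror else NE_Mirror)
                       else No_Mirror)
       (bernoulli_pmf p)"

definition environment_law :: "model \<Rightarrow> real \<Rightarrow> environment measure" where
  "environment_law M p = (\<Pi>\<^sub>M v\<in>UNIV. measure_pmf (site_law M p v))"

definition rectangle :: "int \<Rightarrow> int \<Rightarrow> vertex set" where
  "rectangle m h = {1..m} \<times> {1..h}"

definition Cross_between :: "int \<Rightarrow> int \<Rightarrow> int \<Rightarrow> int \<Rightarrow> environment set" where
  "Cross_between i j m h =
     {\<omega>. \<exists>es. trajectory_segment \<omega> es \<and>
          hd es = ((i, 0), (i, 1)) \<and> last es = ((j, h), (j, h + 1)) \<and>
          intermediate_vertices es \<subseteq> rectangle m h}"

definition Cross :: "int \<Rightarrow> int \<Rightarrow> environment set" where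
  "Cross m h = (\<Union>i\<in>{1..m}. \<Union>j\<in>{1..m}. Cross_between i j m h)"

definition square :: "real \<Rightarrow> vertex set" where
  "square r = {(x, y). real_of_int x \<in> {-r..r} \<and> real_of_int y \<in> {-r..r}}"

definition PlaneLoc :: "real \<Rightarrow> environment set" where
  "PlaneLoc m =
     {\<omega>. \<forall>e. trajectory \<omega> e \<and> fst (e 0) \<in> square 1 \<longrightarrow> remains_in e (square m)}"

end

(*
Cover Z^2 by tiles of side 96n and surround each by the concentric box of radius 49n. A trajectory
that visits a tile and later leaves its box does so through one of the four sides, so it crosses,
the short way, one of four isometric copies of the 100n x n rectangle. Such a tile is called bad.
The isometries can be chosen to preserve either law, so a tile is bad with probability at most 4q,
q being the crossing probability, and tiles at sup-distance at least 2 are bad independently.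

A trajectory reaching distance m visits only bad tiles until it is close to its end point. Always
jumping to the tile that follows the last visit to the neighbourhood of the current one yields N of
order m/n bad tiles that are pairwise at distance at least 2, with jumps of length at most 2.
There are at most 25^N such sequences, each of probability at most (4q)^N, so a union bound
gives (100q)^N.
*)

theory Submission
  imports Defs
begin

section \<open>Sup-distance on the lattice and separated skeletons of paths\<close>

definition sup_dist :: "vertex \<Rightarrow> vertex \<Rightarrow> int" where
  "sup_dist u v = max \<bar>fst u - fst v\<bar> \<bar>snd u - snd v\<bar>"

lemma sup_dist_self [simp]: "sup_dist u u = 0"
  by (simp add: sup_dist_def)

lemma sup_dist_commute: "sup_dist u v = sup_dist v u"
  by (simp add: sup_dist_def abs_minus_commute)

lemma sup_dist_le_iff: "sup_dist u v \<le> r \<longleftrightarrow> \<bar>fst u - fst v\<bar> \<le> r \<and> \<bar>snd u - snd v\<bar> \<le> r"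
  by (simp add: sup_dist_def)

lemma sup_dist_ge: "\<bar>fst u - fst v\<bar> \<le> sup_dist u v" "\<bar>snd u - snd v\<bar> \<le> sup_dist u v"
  by (simp_all add: sup_dist_def)

lemma sup_dist_triangle: "sup_dist u w \<le> sup_dist u v + sup_dist v w"
  using sup_dist_ge[of u v] sup_dist_ge[of v w] unfolding sup_dist_le_iff by (intro conjI; linarith)

text \<open>Last-visit times: used to pick the next skeleton point and to cut a crossing out of a
  trajectory.\<close>

lemma last_index:
  fixes P :: "nat \<Rightarrow> bool"
  assumes "P a" "\<not> P b" "a \<le> b"
  obtains l where "a \<le> l" "l < b" "P l" "\<And>j. l < j \<Longrightarrow> j \<le> b \<Longrightarrow> \<not> P j"
proof -
  define S where "S = {l. a \<le> l \<and> l \<le> b \<and> P l}"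
  have S: "finite S" "a \<in> S" using assms by (auto simp: S_def)
  have "S \<noteq> {}" using S(2) by auto
  then have Max: "Max S \<in> S" by (rule Max_in[OF S(1)])
  then have M: "a \<le> Max S" "Max S \<le> b" "P (Max S)" by (simp_all add: S_def)
  show thesis
  proof (rule that[OF M(1) _ M(3)])
    show "Max S < b" using M(2,3) assms(2) by (metis le_neq_implies_less)
    show "\<not> P j" if j: "Max S < j" "j \<le> b" for j
    proof
      assume "P j"
      with j M(1) have "j \<in> S" by (simp add: S_def)
      then show False using Max_ge[OF S(1)] j(1) by (meson leD)
    qed
  qed
qed

text \<open>
  The next point is the one following the last visit to the unit ball around the current point:
  every later point is then far from it, so separation from all earlier points is automatic.
\<close>

lemma skeleton_exists:
  assumes "\<forall>i<K. sup_dist (f i) (f (Suc i)) \<le> 1"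
    and "2 * int N \<le> sup_dist (f 0) (f K)"
  shows "\<exists>us. length us = N \<and> (us \<noteq> [] \<longrightarrow> hd us = f 0) \<and>
    successively (\<lambda>u v. sup_dist u v \<le> 2) us \<and> sorted_wrt (\<lambda>u v. 2 \<le> sup_dist u v) us \<and>
    (\<forall>u\<in>set us. u \<in> f ` {..K} \<and> 2 \<le> sup_dist u (f K))"
  using assms
proof (induction N arbitrary: f K)
  case 0
  then show ?case by simp
next
  case (Suc N)
  obtain \<tau> where \<tau>: "\<tau> < K" "sup_dist (f 0) (f \<tau>) \<le> 1"
    and last: "\<And>j. \<tau> < j \<Longrightarrow> j \<le> K \<Longrightarrow> \<not> sup_dist (f 0) (f j) \<le> 1"
    using Suc.prems(2) last_index[of "\<lambda>j. sup_dist (f 0) (f j) \<le> 1" 0 K] by auto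
  define g where "g i = f (Suc \<tau> + i)" for i
  have near: "sup_dist (f 0) (g 0) \<le> 2"
    using sup_dist_triangle[of "f 0" "f (Suc \<tau>)" "f \<tau>"] \<tau> Suc.prems(1)[rule_format, of \<tau>] by (simp add: g_def)
  have gK: "g (K - Suc \<tau>) = f K" using \<tau> by (simp add: g_def)
  \<comment> \<open>A jump has length at most 2, so it uses up one of the \<open>Suc N\<close> units
    of 2 in the hypothesis.\<close>
  have dist_g: "2 * int N \<le> sup_dist (g 0) (g (K - Suc \<tau>))"
    using Suc.prems(2) near sup_dist_triangle[of "f 0" "f K" "g 0"] gK by simp
  have step_g: "\<forall>i<K - Suc \<tau>. sup_dist (g i) (g (Suc i)) \<le> 1"
    using Suc.prems(1) by (simp add: g_def)
  from Suc.IH[of "K - Suc \<tau>" g, OF step_g dist_g]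
  obtain us where us: "length us = N" "us \<noteq> [] \<longrightarrow> hd us = g 0"
      "successively (\<lambda>u v. sup_dist u v \<le> 2) us" "sorted_wrt (\<lambda>u v. 2 \<le> sup_dist u v) us"
      "\<forall>u\<in>set us. u \<in> g ` {..K - Suc \<tau>} \<and> 2 \<le> sup_dist u (g (K - Suc \<tau>))"
    by (elim exE conjE) (rule that)
  have far: "u \<in> f ` {..K} \<and> 2 \<le> sup_dist (f 0) u \<and> 2 \<le> sup_dist u (f K)" if u: "u \<in> set us" for u
  proof -
    have "u \<in> g ` {..K - Suc \<tau>}" and uK: "2 \<le> sup_dist u (f K)" using us(5) u gK by simp_all
    then obtain i where i: "u = g i" "i \<le> K - Suc \<tau>" by (elim imageE) simp
    have le: "Suc \<tau> + i \<le> K" using i(2) \<tau>(1) by linarith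
    then have "u \<in> f ` {..K}" by (auto simp: i(1) g_def)
    \<comment> \<open>Distances are integers, so not at most 1 means at least 2.\<close>
    moreover have "2 \<le> sup_dist (f 0) u"
      using last[of "Suc \<tau> + i"] le by (simp add: i(1) g_def)
    ultimately show ?thesis using uK by simp
  qed
  have "f 0 \<in> f ` {..K}" by (rule imageI) simp
  with far Suc.prems(2) have "\<forall>u\<in>set (f 0 # us). u \<in> f ` {..K} \<and> 2 \<le> sup_dist u (f K)"
    by (simp del: image_iff)
  moreover have "sorted_wrt (\<lambda>u v. 2 \<le> sup_dist u v) (f 0 # us)"
    using us(4) far by simp
  moreover have "successively (\<lambda>u v. sup_dist u v \<le> 2) (f 0 # us)"
    using us(2,3) near by (auto simp: successively_Cons)
  moreover have "length (f 0 # us) = Suc N" "hd (f 0 # us) = f 0" using us(1) by simp_all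
  ultimately show ?case by (intro exI conjI impI)
qed

section \<open>Counting walks\<close>

text \<open>The guard on \<open>hd\<close> admits the empty list, the only walk of length 0, for
  every start.\<close>

definition walks :: "nat \<Rightarrow> vertex \<Rightarrow> vertex list set" where
  "walks N a = {us. length us = N \<and> (us \<noteq> [] \<longrightarrow> hd us = a) \<and>
     successively (\<lambda>u v. sup_dist u v \<le> 2) us}"

lemma sup_ball: "{v. sup_dist u v \<le> 2} = {fst u - 2..fst u + 2} \<times> {snd u - 2..snd u + 2}"
  by (auto simp: sup_dist_def)

text \<open>A sup-ball of radius 2 has \<open>5 * 5 = 25\<close> points, so deleting the first point
  of a walk leaves at most 25 starts for the rest.\<close>

lemma card_walks: "finite (walks N a) \<and> card (walks N a) \<le> 25 ^ N"
proof (induction N arbitrary: a)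
  case 0
  have "walks 0 a = {[]}" by (auto simp: walks_def)
  then show ?case by simp
next
  case (Suc N)
  let ?B = "{v. sup_dist a v \<le> 2}"
  have B: "finite ?B" "card ?B = 25" by (simp_all add: sup_ball card_cartesian_product)
  have sub: "walks (Suc N) a \<subseteq> (\<Union>b\<in>?B. (#) a ` walks N b)"
  proof
    fix vs assume "vs \<in> walks (Suc N) a"
    then obtain us where us: "vs = a # us" "length us = N"
        "us \<noteq> [] \<longrightarrow> sup_dist a (hd us) \<le> 2" "successively (\<lambda>u v. sup_dist u v \<le> 2) us"
      by (auto simp: walks_def length_Suc_conv successively_Cons)
    \<comment> \<open>A walk of length 1 has no second point; any point of the ball would do, and
      \<open>a\<close> is one.\<close>
    let ?b = "if us = [] then a else hd us"
    from us have "?b \<in> ?B" "us \<in> walks N ?b" by (auto simp: walks_def)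
    then show "vs \<in> (\<Union>b\<in>?B. (#) a ` walks N b)" unfolding us(1) by blast
  qed
  have fin: "finite (\<Union>b\<in>?B. (#) a ` walks N b)" using B Suc by blast
  have "card (walks (Suc N) a) \<le> card (\<Union>b\<in>?B. (#) a ` walks N b)"
    by (rule card_mono[OF fin sub])
  also have "\<dots> \<le> (\<Sum>b\<in>?B. card ((#) a ` walks N b))"
    by (rule card_UN_le[OF B(1)])
  also have "\<dots> \<le> (\<Sum>b\<in>?B. 25 ^ N)"
    by (intro sum_mono) (meson Suc card_image_le le_trans)
  finally show ?case using finite_subset[OF sub fin] B by simp
qed

section \<open>Trajectories and crossings of a rectangle\<close>

lemma follows_directed: "follows \<omega> e e' \<Longrightarrow> directed_edge e'"
  by (auto simp: follows_def directed_edge_def)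

lemma trajectory_follows: "trajectory \<omega> e \<Longrightarrow> follows \<omega> (e k) (e (Suc k))"
  by (simp add: trajectory_def)

lemma trajectory_directed: "trajectory \<omega> e \<Longrightarrow> directed_edge (e k)"
  by (cases k) (auto simp: trajectory_def intro: follows_directed)

lemma trajectory_snd: "trajectory \<omega> e \<Longrightarrow> snd (e k) = fst (e (Suc k))"
  using trajectory_follows[of \<omega> e k] by (simp add: follows_def)

lemma trajectory_step:
  assumes "trajectory \<omega> e"
  obtains d where "fst (e (Suc k)) = fst (e k) + step d"
  using trajectory_directed[OF assms, of k] trajectory_snd[OF assms, of k]
  by (auto simp: directed_edge_def)

lemma trajectory_segment_of_trajectory:
  assumes "trajectory \<omega> e" "l < k"
  shows "trajectory_segment \<omega> (map e [l..<k])"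
  using assms trajectory_directed[OF assms(1)] trajectory_follows[OF assms(1)]
  by (auto simp: trajectory_segment_def successively_conv_nth)

text \<open>A step that passes a horizontal level is a \<open>North\<close> step, so a path enters
  and leaves a strip by vertical edges, as \<open>Cross_between\<close> requires.\<close>

lemma step_up:
  assumes "snd v \<le> (y::int)" "y < snd (v + step d)"
  shows "snd v = y" "v + step d = (fst v, y + 1)"
  using assms by (cases d; cases v; simp)+

text \<open>The crossing starts at the last visit to height at most 0.\<close>

lemma crossing_of_trajectory:
  assumes e: "trajectory \<omega> e" and "i \<le> k" and start: "snd (fst (e i)) \<le> 0"
    and fin: "h < snd (fst (e k))" and h: "1 \<le> h"
    and inside: "\<And>j. i \<le> j \<Longrightarrow> j < k \<Longrightarrow> fst (fst (e j)) \<in> {1..m} \<and> snd (fst (e j)) \<le> h"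
  shows "\<omega> \<in> Cross m h"
proof -
  obtain l where l: "i \<le> l" "l < k" "snd (fst (e l)) \<le> 0"
    and above: "\<And>j. l < j \<Longrightarrow> j \<le> k \<Longrightarrow> \<not> snd (fst (e j)) \<le> 0"
  proof (rule last_index[of "\<lambda>j. snd (fst (e j)) \<le> 0" i k])
    show "\<not> snd (fst (e k)) \<le> 0" using fin h by simp
  qed (use start \<open>i \<le> k\<close> in auto)
  obtain d where d: "fst (e (Suc l)) = fst (e l) + step d" using trajectory_step[OF e] .
  have l0: "snd (fst (e l)) = 0" "fst (e (Suc l)) = (fst (fst (e l)), 1)"
    using step_up[OF l(3), of d] above[of "Suc l"] l d by auto
  \<comment> \<open>One step above level 0 is height \<open>1 \<le> h\<close>, still short of the
    height at time \<open>k\<close>, so the entry and exit edges are distinct.\<close>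
  have lk: "Suc l < k" using l fin h l0(2) by (cases "Suc l = k") auto
  then obtain k' where k: "k = Suc k'" "l < k'" by (cases k) auto
  obtain d' where d': "fst (e k) = fst (e k') + step d'" using trajectory_step[OF e] k by metis
  have k'0: "snd (fst (e k')) = h" "fst (e k) = (fst (fst (e k')), h + 1)"
    using step_up[of "fst (e k')" h d'] inside[of k'] l k fin d' by auto
  define es where "es = map e [l..<k]"
  have "trajectory_segment \<omega> es"
    unfolding es_def by (rule trajectory_segment_of_trajectory[OF e l(2)])
  moreover have "hd es = ((fst (fst (e l)), 0), (fst (fst (e l)), 1))"
    using l l0 trajectory_snd[OF e, of l] unfolding es_def by (simp add: hd_map prod_eq_iff)
  moreover have "last es = ((fst (fst (e k')), h), (fst (fst (e k')), h + 1))"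
    using l k k'0 trajectory_snd[OF e, of k'] unfolding es_def by (simp add: last_map prod_eq_iff)
  \<comment> \<open>The intermediate vertices are those at times \<open>Suc l\<close> to
    \<open>k'\<close>: the choice of \<open>l\<close> puts them above level 0, and
    \<open>inside\<close> gives the other bounds.\<close>
  moreover have "intermediate_vertices es \<subseteq> rectangle m h"
  proof -
    have "fst (e (Suc j)) \<in> rectangle m h" if "l \<le> j" "j < k'" for j
      using inside[of "Suc j"] above[of "Suc j"] that k l
      by (cases "fst (e (Suc j))") (auto simp: rectangle_def)
    then show ?thesis
      using k by (auto simp: es_def intermediate_vertices_def butlast_append trajectory_snd[OF e])
  qed
  moreover have "fst (fst (e l)) \<in> {1..m}" "fst (fst (e k')) \<in> {1..m}"
    using inside[of l] inside[of k'] l k by auto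
  ultimately show ?thesis unfolding Cross_def Cross_between_def by blast
qed

section \<open>Lattice symmetries preserving the reflection rule\<close>

text \<open>
  The four lattice isometries fixing the origin that preserve both kinds of mirror (and the parity
  of \<open>x - y\<close>); \<open>turn c\<close> exchanges \<open>c\<close> and \<open>North\<close>. Being involutions, each is its own inverse.
\<close>

fun turn :: "direction \<Rightarrow> vertex \<Rightarrow> vertex" where
  "turn North (x, y) = (x, y)"
| "turn East (x, y) = (y, x)"
| "turn South (x, y) = (- x, - y)"
| "turn West (x, y) = (- y, - x)"

fun turn_dir :: "direction \<Rightarrow> direction \<Rightarrow> direction" where
  "turn_dir North d = d"
| "turn_dir East d = (case d of North \<Rightarrow> East | East \<Rightarrow> North | South \<Rightarrow> West | West \<Rightarrow> South)"
| "turn_dir South d = (case d of North \<Rightarrow> South | East \<Rightarrow> West | South \<Rightarrow> North | West \<Rightarrow> East)"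
| "turn_dir West d = (case d of North \<Rightarrow> West | East \<Rightarrow> South | South \<Rightarrow> East | West \<Rightarrow> North)"

lemma turn_turn [simp]: "turn c (turn c v) = v"
  by (cases c; cases v) auto

lemma turn_add: "turn c (u + v) = turn c u + turn c v"
  by (cases c; cases u; cases v) auto

lemma turn_step: "turn c (step d) = step (turn_dir c d)"
  by (cases c; cases d) auto

lemma partner_turn_dir: "partner s (turn_dir c d) = turn_dir c (partner s d)"
  by (cases s; cases c; cases d) auto

text \<open>Passes from the coordinates in which \<open>Cross\<close> is stated to the lattice,
  sending \<open>s\<close> to \<open>z\<close>; \<open>unframe\<close> passes back.\<close>

definition frame :: "vertex \<Rightarrow> vertex \<Rightarrow> direction \<Rightarrow> vertex \<Rightarrow> vertex" where
  "frame z s c v = z + turn c (v - s)"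

definition unframe :: "vertex \<Rightarrow> vertex \<Rightarrow> direction \<Rightarrow> vertex \<Rightarrow> vertex" where
  "unframe z s c v = turn c (v - z) + s"

lemma frame_unframe [simp]: "frame z s c (unframe z s c v) = v"
  by (simp add: frame_def unframe_def)

lemma unframe_frame [simp]: "unframe z s c (frame z s c v) = v"
  by (simp add: frame_def unframe_def)

lemma unframe_step: "unframe z s c (v + step d) = unframe z s c v + step (turn_dir c d)"
proof -
  have "v + step d - z = (v - z) + step d" by simp
  then show ?thesis unfolding unframe_def by (simp only: turn_add turn_step add_ac)
qed

text \<open>Pulling the environment back along \<open>frame\<close> while moving edges by its
  inverse lets each edge meet the same state as before, and \<open>partner\<close> commutes with
  \<open>turn_dir\<close>.\<close>

lemma trajectory_unframe:
  assumes "trajectory \<omega> e"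
  shows "trajectory (\<omega> \<circ> frame z s c) (map_prod (unframe z s c) (unframe z s c) \<circ> e)"
proof -
  have "follows (\<omega> \<circ> frame z s c) (map_prod (unframe z s c) (unframe z s c) a)
          (map_prod (unframe z s c) (unframe z s c) b)" if "follows \<omega> a b" for a b
  proof -
    from that obtain d where d: "fst b = snd a" "fst a = snd a + step d"
        "snd b = snd a + step (partner (\<omega> (snd a)) d)" by (auto simp: follows_def)
    then show ?thesis
      by (auto simp: follows_def unframe_step partner_turn_dir intro!: exI[of _ "turn_dir c d"])
  qed
  moreover have "directed_edge (map_prod (unframe z s c) (unframe z s c) a)"
    if "directed_edge a" for a
    using that by (auto simp: directed_edge_def unframe_step)
  ultimately show ?thesis using assms by (simp add: trajectory_def)
qed

section \<open>Tiles, bad tiles and escaping trajectories\<close>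

text \<open>The shift by \<open>48 * n\<close> centres tile \<open>u\<close> at
  \<open>centre n u\<close>, making it half-open with half-width \<open>48 * n\<close>.\<close>

definition tile :: "int \<Rightarrow> vertex \<Rightarrow> vertex" where
  "tile n v = ((fst v + 48 * n) div (96 * n), (snd v + 48 * n) div (96 * n))"

definition centre :: "int \<Rightarrow> vertex \<Rightarrow> vertex" where
  "centre n u = (96 * n * fst u, 96 * n * snd u)"

text \<open>
  Carries \<open>rectangle (100 * n) n\<close> to the strip between distances \<open>48 * n\<close> and \<open>49 * n\<close> from
  the tile centre, on side \<open>c\<close>. Both translation vectors have even coordinates for every \<open>n\<close>,
  as invariance of the Manhattan law requires.
\<close>

definition tile_frame :: "int \<Rightarrow> vertex \<Rightarrow> direction \<Rightarrow> vertex \<Rightarrow> vertex" where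
  "tile_frame n u = frame (centre n u) (50 * n, - 48 * n)"

definition bad :: "int \<Rightarrow> vertex \<Rightarrow> environment set" where
  "bad n u = {\<omega>. \<exists>c. \<omega> \<circ> tile_frame n u c \<in> Cross (100 * n) n}"

lemma tile_coord:
  assumes "0 < (n::int)"
  shows "\<bar>x - 96 * n * ((x + 48 * n) div (96 * n))\<bar> \<le> 48 * n"
proof -
  have "x + 48 * n = 96 * n * ((x + 48 * n) div (96 * n)) + (x + 48 * n) mod (96 * n)" by simp
  moreover have "0 \<le> (x + 48 * n) mod (96 * n)" "(x + 48 * n) mod (96 * n) < 96 * n"
    using assms by simp_all
  ultimately show ?thesis by linarith
qed

lemma sup_dist_centre_tile: "0 < n \<Longrightarrow> sup_dist v (centre n (tile n v)) \<le> 48 * n"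
  using tile_coord[of n "fst v"] tile_coord[of n "snd v"]
  by (simp add: sup_dist_def centre_def tile_def)

lemma sup_dist_centre: "0 < n \<Longrightarrow> sup_dist (centre n u) (centre n v) = 96 * n * sup_dist u v"
  unfolding sup_dist_def centre_def fst_conv snd_conv right_diff_distrib[symmetric] abs_mult
  by (simp add: max_mult_distrib_left)

lemma div_step:
  assumes "0 < (b::int)" "\<bar>x - y\<bar> \<le> 1"
  shows "\<bar>x div b - y div b\<bar> \<le> 1"
proof -
  have *: "x' div b \<le> y' div b + 1" if "x' \<le> y' + 1" for x' y' :: int
  proof -
    have "x' div b \<le> (y' + b) div b" using assms that by (intro zdiv_mono1) auto
    then show ?thesis using assms by simp
  qed
  show ?thesis using *[of x y] *[of y x] assms by linarith
qed

lemma tile_step: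
  assumes "0 < n"
  shows "sup_dist (tile n v) (tile n (v + step d)) \<le> 1"
proof -
  have "\<bar>fst v + 48 * n - (fst (v + step d) + 48 * n)\<bar> \<le> 1"
    "\<bar>snd v + 48 * n - (snd (v + step d) + 48 * n)\<bar> \<le> 1" by (cases d; simp)+
  then show ?thesis
    using div_step[of "96 * n"] assms by (simp add: sup_dist_def tile_def)
qed

text \<open>Stop at the first exit \<open>t\<close> from the box of radius \<open>49 * n\<close>,
  and let \<open>c\<close> be the side crossed. In the frame of \<open>c\<close> the path starts at
  height at most \<open>48 * n - 48 * n = 0\<close> and ends above
  \<open>49 * n - 48 * n = n\<close>; before \<open>t\<close> its horizontal coordinate is within
  \<open>49 * n\<close> of \<open>50 * n\<close>, hence in \<open>{1..100 * n}\<close>.\<close>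

lemma bad_of_trajectory:
  assumes e: "trajectory \<omega> e" and n: "0 < n" and ik: "i \<le> k"
    and i: "sup_dist (fst (e i)) (centre n u) \<le> 48 * n"
    and k: "49 * n < sup_dist (fst (e k)) (centre n u)"
  shows "\<omega> \<in> bad n u"
proof -
  let ?z = "centre n u"
  define t where "t = (LEAST t. i \<le> t \<and> 49 * n < sup_dist (fst (e t)) ?z)"
  have t: "i \<le> t" "49 * n < sup_dist (fst (e t)) ?z"
    using LeastI[of "\<lambda>t. i \<le> t \<and> 49 * n < sup_dist (fst (e t)) ?z" k] ik k
    unfolding t_def by auto
  have before: "sup_dist (fst (e j)) ?z \<le> 49 * n" if "i \<le> j" "j < t" for j
    using not_less_Least[of j "\<lambda>t. i \<le> t \<and> 49 * n < sup_dist (fst (e t)) ?z"] that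
    unfolding t_def by auto
  \<comment> \<open>Some signed coordinate exceeds \<open>49 * n\<close>; the four turns bring each
    of the four into second position.\<close>
  have "\<exists>c. 49 * n < snd (turn c (fst (e t) - ?z))"
  proof -
    obtain x y where xy: "fst (e t) - ?z = (x, y)" by (cases "fst (e t) - ?z")
    then have "fst (fst (e t)) - fst ?z = x" "snd (fst (e t)) - snd ?z = y"
      by (metis fst_conv fst_diff, metis snd_conv snd_diff)
    then have "49 * n < y \<or> 49 * n < x \<or> 49 * n < - y \<or> 49 * n < - x"
      using t(2) by (auto simp: sup_dist_def less_max_iff_disj)
    then show ?thesis
      using xy turn.simps by (metis snd_conv)
  qed
  then obtain c where c: "49 * n < snd (turn c (fst (e t) - ?z))" by blast
  let ?s = "(50 * n, - 48 * n)"
  let ?e = "map_prod (unframe ?z ?s c) (unframe ?z ?s c) \<circ> e"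
  have traj: "trajectory (\<omega> \<circ> tile_frame n u c) ?e"
    unfolding tile_frame_def by (rule trajectory_unframe[OF e])
  have bound: "\<bar>fst (turn c (v - ?z))\<bar> \<le> r" "\<bar>snd (turn c (v - ?z))\<bar> \<le> r"
    if "sup_dist v ?z \<le> r" for v r
    using that by (cases c; cases v; cases ?z; auto simp: sup_dist_def)+
  have "\<omega> \<circ> tile_frame n u c \<in> Cross (100 * n) n"
  proof (rule crossing_of_trajectory[OF traj t(1)])
    show "snd (fst (?e i)) \<le> 0" using bound(2)[OF i] by (simp add: unframe_def)
    show "n < snd (fst (?e t))" using c by (simp add: unframe_def)
    show "1 \<le> n" using n by simp
    show "fst (fst (?e j)) \<in> {1..100 * n} \<and> snd (fst (?e j)) \<le> n" if "i \<le> j" "j < t" for j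
      using bound[OF before[OF that]] n by (auto simp: unframe_def)
  qed
  then show ?thesis by (auto simp: bad_def)
qed

text \<open>A vertex is within \<open>48 * n\<close>, half a tile, of its tile centre; this is the
  \<open>1 / 2\<close> lost when distances are measured in tiles.\<close>

lemma tile_far:
  assumes "0 < n" "real_of_int (sup_dist v 0) > m" "2 * real N \<le> m / (96 * n) - 1 / 2"
  shows "2 * int N \<le> sup_dist 0 (tile n v)"
proof -
  have "sup_dist v 0 \<le> sup_dist v (centre n (tile n v)) + sup_dist (centre n (tile n v)) 0"
    by (rule sup_dist_triangle)
  also have "sup_dist (centre n (tile n v)) 0 = 96 * n * sup_dist 0 (tile n v)"
    using sup_dist_centre[OF assms(1), of "tile n v" 0]
    by (simp add: centre_def sup_dist_commute zero_prod_def)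
  finally have "sup_dist v 0 \<le> 48 * n + 96 * n * sup_dist 0 (tile n v)"
    using sup_dist_centre_tile[OF assms(1), of v] by linarith
  then have "real_of_int (sup_dist v 0) \<le> real_of_int (48 * n + 96 * n * sup_dist 0 (tile n v))"
    by (rule of_int_le_iff[THEN iffD2])
  then have "m / (96 * n) \<le> 1 / 2 + sup_dist 0 (tile n v)"
    using assms(1,2) by (simp add: field_simps)
  then have "real_of_int (2 * int N) \<le> real_of_int (sup_dist 0 (tile n v))"
    using assms(3) by simp
  then show ?thesis by (rule of_int_le_iff[THEN iffD1])
qed

text \<open>Applies \<open>skeleton_exists\<close> to the sequence of tiles visited up to a time
  \<open>K\<close> outside the square.\<close>

lemma escape_imp_bad_walk:
  assumes e: "trajectory \<omega> e" and n: "0 < n"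
    and start: "fst (e 0) \<in> square 1" and out: "\<not> remains_in e (square m)"
    and N: "2 * real N \<le> m / (96 * n) - 1 / 2"
  shows "\<exists>us\<in>walks N 0. sorted_wrt (\<lambda>u v. 2 \<le> sup_dist u v) us \<and> (\<forall>u\<in>set us. \<omega> \<in> bad n u)"
proof -
  obtain K where K: "fst (e K) \<notin> square m"
    using out trajectory_snd[OF e] by (auto simp: remains_in_def)
  have K: "real_of_int (sup_dist (fst (e K)) 0) > m"
    using K by (cases "fst (e K)") (auto simp: square_def sup_dist_def)
  let ?f = "\<lambda>i. tile n (fst (e i))"
  \<comment> \<open>All permitted starting vertices lie in tile 0, so all walks share one
    start.\<close>
  have "0 \<le> x + 48 * n \<and> x + 48 * n < 96 * n" if "- 1 \<le> x" "x \<le> 1" for x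
    using that n by auto
  then have f0: "?f 0 = 0"
    using start by (cases "fst (e 0)") (auto simp: tile_def square_def zero_prod_def)
  have far: "2 * int N \<le> sup_dist (?f 0) (?f K)" using tile_far[OF n K N] f0 by simp
  have "sup_dist (?f i) (?f (Suc i)) \<le> 1" for i
    using trajectory_step[OF e, of i] tile_step[OF n] by metis
  then obtain us where us: "length us = N" "us \<noteq> [] \<longrightarrow> hd us = ?f 0"
    "successively (\<lambda>u v. sup_dist u v \<le> 2) us" "sorted_wrt (\<lambda>u v. 2 \<le> sup_dist u v) us"
    "\<forall>u\<in>set us. u \<in> ?f ` {..K} \<and> 2 \<le> sup_dist u (?f K)"
    using skeleton_exists[of K ?f N] far by blast
  have "\<omega> \<in> bad n u" if "u \<in> set us" for u
  proof -
    have "u \<in> ?f ` {..K}" using us(5) that by simp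
    then obtain i where i: "i \<le> K" "u = ?f i" by auto
    \<comment> \<open>Centres of tiles at distance 2 or more are at least \<open>192 * n\<close>
      apart, and \<open>fst (e K)\<close> is within \<open>48 * n\<close> of its own, leaving
      \<open>144 * n > 49 * n\<close>: the trajectory has left the box of \<open>u\<close>.\<close>
    have "96 * n * 2 \<le> 96 * n * sup_dist (?f K) u"
      using us(5) that n by (intro mult_left_mono) (auto simp: sup_dist_commute)
    also have "\<dots> = sup_dist (centre n (?f K)) (centre n u)" using sup_dist_centre[OF n] by simp
    also have "\<dots> \<le> sup_dist (centre n (?f K)) (fst (e K)) + sup_dist (fst (e K)) (centre n u)"
      by (rule sup_dist_triangle)
    finally have "49 * n < sup_dist (fst (e K)) (centre n u)"
      using sup_dist_centre_tile[OF n, of "fst (e K)"] n by (simp add: sup_dist_commute)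
    then show ?thesis
      using bad_of_trajectory[OF e n i(1), of u] sup_dist_centre_tile[OF n] i(2) by simp
  qed
  moreover have "us \<in> walks N 0" using us(1-3) f0 by (simp add: walks_def)
  ultimately show ?thesis using us(4) by blast
qed

section \<open>Site laws and measurability\<close>

lemma site_law_tile_frame: "site_law M p (tile_frame n u c v) = site_law M p v"
proof (cases M)
  case Manhattan
  obtain x y where v: "v = (x, y)" by (cases v)
  \<comment> \<open>The translations are even and each turn changes \<open>x - y\<close> at most in
    sign.\<close>
  have "even (fst (tile_frame n u c v) - snd (tile_frame n u c v)) \<longleftrightarrow> even (x - y)"
    unfolding v tile_frame_def frame_def centre_def by (cases c) auto
  then show ?thesis
    unfolding Manhattan v by (cases "tile_frame n u c (x, y)") simp
qed simp

lemma prob_space_environment_law: "prob_space (environment_law M p)"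
  unfolding environment_law_def by (intro prob_space_PiM prob_space_measure_pmf)

lemma space_environment_law [simp]: "space (environment_law M p) = UNIV"
  by (simp add: environment_law_def space_PiM)

lemma pred_site [measurable]: "Measurable.pred (environment_law M p) (\<lambda>\<omega>. Q (\<omega> v))"
proof -
  have "(\<lambda>\<omega>. \<omega> v) \<in> measurable (environment_law M p) (measure_pmf (site_law M p v))"
    unfolding environment_law_def by (rule measurable_component_singleton) simp
  then have "(\<lambda>\<omega>. \<omega> v) \<in> measurable (environment_law M p) (count_space UNIV)"
    by (simp cong: measurable_cong_sets)
  then show ?thesis by (rule measurable_compose) simp
qed

lemma pred_follows [measurable]: "Measurable.pred (environment_law M p) (\<lambda>\<omega>. follows \<omega> a b)"
  unfolding follows_def by (rule pred_site)

lemma pred_trajectory_segment [measurable]: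
  "Measurable.pred (environment_law M p) (\<lambda>\<omega>. trajectory_segment \<omega> es)"
proof -
  have "Measurable.pred (environment_law M p) (\<lambda>\<omega>. successively (follows \<omega>) es)"
    by (induction es rule: induct_list012) auto
  then show ?thesis unfolding trajectory_segment_def by measurable
qed

text \<open>There are countably many edge lists, so the existential is a countable union;
  \<open>Q\<close> does not see the environment and may be arbitrary.\<close>

lemma measurable_trajectory_segments:
  "{\<omega>. \<exists>es. trajectory_segment \<omega> es \<and> Q es} \<in> sets (environment_law M p)"
proof -
  have "Measurable.pred (environment_law M p) (\<lambda>\<omega>. \<exists>es. trajectory_segment \<omega> es \<and> Q es)"
    by measurable
  then show ?thesis by (simp add: pred_def)
qed

lemma measurable_Cross: "Cross m h \<in> sets (environment_law M p)"
proof -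
  have "Cross_between i j m h \<in> sets (environment_law M p)" for i j
    unfolding Cross_between_def by (rule measurable_trajectory_segments)
  then show ?thesis unfolding Cross_def by auto
qed

section \<open>Measurability of the localization event\<close>

definition next_edge :: "environment \<Rightarrow> edge \<Rightarrow> edge" where
  "next_edge \<omega> e = (SOME e'. follows \<omega> e e')"

lemma follows_next_edge:
  assumes "directed_edge e"
  shows "follows \<omega> e (next_edge \<omega> e)"
proof -
  obtain d where "snd e = fst e + step d" using assms by (auto simp: directed_edge_def)
  \<comment> \<open>\<open>turn_dir South\<close> reverses directions; it supplies the half-edge
    pointing back, along which the ray arrives.\<close>
  moreover have "step (turn_dir South d) = - step d" by (cases d) simp_all
  ultimately obtain d' where "fst e = snd e + step d'"
    by (metis add_diff_cancel_right' diff_conv_add_uminus)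
  then have "follows \<omega> e (snd e, snd e + step (partner (\<omega> (snd e)) d'))"
    by (auto simp: follows_def)
  then show ?thesis unfolding next_edge_def by (rule someI)
qed

text \<open>Links finite segments to the infinite trajectories of \<open>PlaneLoc\<close>: iterate
  \<open>next_edge\<close> from the last edge.\<close>

lemma trajectory_segment_extend:
  assumes "trajectory_segment \<omega> es"
  obtains e where "trajectory \<omega> e" "\<And>k. k < length es \<Longrightarrow> e k = es ! k"
proof
  \<comment> \<open>The exponent is 0 at \<open>k = length es - 1\<close>, so both branches agree
    there and the recursion already covers the step leaving the segment.\<close>
  define e where "e k = (if k < length es then es ! k
      else (next_edge \<omega> ^^ (Suc k - length es)) (last es))" for k
  have es: "es \<noteq> []" "\<And>a. a \<in> set es \<Longrightarrow> directed_edge a"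
      "\<And>i. Suc i < length es \<Longrightarrow> follows \<omega> (es ! i) (es ! Suc i)"
    using assms by (auto simp: trajectory_segment_def successively_conv_nth)
  have "directed_edge ((next_edge \<omega> ^^ j) (last es))" for j
    by (induction j) (use es in \<open>auto intro: follows_directed[OF follows_next_edge]\<close>)
  then have "follows \<omega> ((next_edge \<omega> ^^ j) (last es)) ((next_edge \<omega> ^^ Suc j) (last es))" for j
    by (simp add: follows_next_edge)
  moreover have "e k = (next_edge \<omega> ^^ (Suc k - length es)) (last es)" if "length es \<le> Suc k" for k
  proof (cases "Suc k = length es")
    case True
    then show ?thesis using es(1) by (simp add: e_def last_conv_nth flip: True)
  next
    case False
    then show ?thesis using that by (simp add: e_def)
  qed
  ultimately have "follows \<omega> (e k) (e (Suc k))" if "length es \<le> Suc k" for k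
    using that by (simp add: Suc_diff_le)
  moreover have "follows \<omega> (e k) (e (Suc k))" if "Suc k < length es" for k
    using that es(3) by (simp add: e_def)
  ultimately have "follows \<omega> (e k) (e (Suc k))" for k
    by (cases "Suc k < length es") auto
  moreover have "directed_edge (e 0)" using es by (simp add: e_def)
  ultimately show "trajectory \<omega> e" by (simp add: trajectory_def)
  show "e k = es ! k" if "k < length es" for k using that by (simp add: e_def)
qed

text \<open>Escape is witnessed by a finite segment, and conversely such a segment extends to a
  trajectory. This replaces a quantifier over the uncountable set of edge sequences by a countable
  one.\<close>

lemma PlaneLoc_eq:
  "PlaneLoc m = - {\<omega>. \<exists>es. trajectory_segment \<omega> es \<and>
     fst (hd es) \<in> square 1 \<and> \<not> (fst (last es) \<in> square m \<and> snd (last es) \<in> square m)}"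
proof (intro equalityI subsetI ComplI)
  fix \<omega> assume loc: "\<omega> \<in> PlaneLoc m"
  assume "\<omega> \<in> {\<omega>. \<exists>es. trajectory_segment \<omega> es \<and>
     fst (hd es) \<in> square 1 \<and> \<not> (fst (last es) \<in> square m \<and> snd (last es) \<in> square m)}"
  then obtain es where es: "trajectory_segment \<omega> es" "fst (hd es) \<in> square 1"
    "\<not> (fst (last es) \<in> square m \<and> snd (last es) \<in> square m)" by auto
  obtain e where e: "trajectory \<omega> e" "\<And>k. k < length es \<Longrightarrow> e k = es ! k"
    using trajectory_segment_extend[OF es(1)] by metis
  have "es \<noteq> []" using es(1) by (simp add: trajectory_segment_def)
  then have "e 0 = hd es" "e (length es - 1) = last es"
    using e(2) by (simp_all add: hd_conv_nth last_conv_nth)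
  moreover from this loc e(1) es(2) have "remains_in e (square m)" by (simp add: PlaneLoc_def)
  ultimately show False using es(3) unfolding remains_in_def by metis
next
  fix \<omega> assume *: "\<omega> \<in> - {\<omega>. \<exists>es. trajectory_segment \<omega> es \<and>
     fst (hd es) \<in> square 1 \<and> \<not> (fst (last es) \<in> square m \<and> snd (last es) \<in> square m)}"
  then have loc: "fst (last es) \<in> square m \<and> snd (last es) \<in> square m"
    if "trajectory_segment \<omega> es" "fst (hd es) \<in> square 1" for es
    using that by blast
  have "fst (e k) \<in> square m \<and> snd (e k) \<in> square m"
    if e: "trajectory \<omega> e" "fst (e 0) \<in> square 1" for e k
  proof -
    have seg: "trajectory_segment \<omega> (map e [0..<Suc k])"
      by (rule trajectory_segment_of_trajectory[OF e(1)]) simp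
    have "hd (map e [0..<Suc k]) = e 0" "last (map e [0..<Suc k]) = e k"
      by (simp_all add: hd_map del: upt_Suc) simp
    then show ?thesis using loc[OF seg] e(2) by simp
  qed
  then show "\<omega> \<in> PlaneLoc m" by (auto simp: PlaneLoc_def remains_in_def)
qed

lemma measurable_PlaneLoc: "PlaneLoc m \<in> sets (environment_law M p)"
proof -
  have compl: "- A \<in> sets (environment_law M p)" if "A \<in> sets (environment_law M p)" for A
    using sets.compl_sets[OF that] by (simp add: Compl_eq_Diff_UNIV)
  show ?thesis unfolding PlaneLoc_eq by (rule compl[OF measurable_trajectory_segments])
qed

section \<open>Invariance of the law and the probability of a bad tile\<close>

lemma distr_environment_law:
  assumes "inj \<phi>" and law: "\<And>v. site_law M p (\<phi> v) = site_law M p v"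
  shows "distr (environment_law M p) (environment_law M p) (\<lambda>\<omega>. \<omega> \<circ> \<phi>) = environment_law M p"
  using distr_PiM_reindex[of UNIV "\<lambda>v. measure_pmf (site_law M p v)" \<phi> UNIV] assms(1)
  by (simp add: law environment_law_def prob_space_measure_pmf comp_def restrict_UNIV)

lemma measurable_reindex:
  assumes law: "\<And>v. site_law M p (\<phi> v) = site_law M p v"
  shows "(\<lambda>\<omega>. \<omega> \<circ> \<phi>) \<in> measurable (environment_law M p) (environment_law M p)"
  unfolding environment_law_def comp_def
proof (rule measurable_PiM_single')
  show "(\<lambda>\<omega>. \<omega> (\<phi> v)) \<in> measurable (\<Pi>\<^sub>M v\<in>UNIV. measure_pmf (site_law M p v)) (measure_pmf (site_law M p v))" for v
    using measurable_component_singleton[of "\<phi> v" UNIV "\<lambda>v. measure_pmf (site_law M p v)"]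
    by (simp add: law)
qed (simp add: space_PiM)

lemma inj_tile_frame: "inj (tile_frame n u c)"
  unfolding tile_frame_def by (rule inj_on_inverseI) (rule unframe_frame)

lemma bad_eq: "bad n u = (\<Union>c. (\<lambda>\<omega>. \<omega> \<circ> tile_frame n u c) -` Cross (100 * n) n)"
  by (auto simp: bad_def)

lemma measurable_bad_part:
  "(\<lambda>\<omega>. \<omega> \<circ> tile_frame n u c) -` Cross (100 * n) n \<in> sets (environment_law M p)"
proof -
  have "(\<lambda>\<omega>. \<omega> \<circ> tile_frame n u c) -` Cross (100 * n) n \<inter> space (environment_law M p)
      \<in> sets (environment_law M p)"
    by (rule measurable_sets[OF measurable_reindex measurable_Cross]) (rule site_law_tile_frame)
  then show ?thesis by simp
qed

lemma UNIV_direction: "(UNIV :: direction set) = {North, East, South, West}"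
  using direction.exhaust by auto

lemma measurable_bad: "bad n u \<in> sets (environment_law M p)"
  unfolding bad_eq UNIV_direction by (auto intro: measurable_bad_part)

text \<open>Union bound over the four sides; by invariance each strip is crossed with the
  probability of the standard rectangle.\<close>

lemma measure_bad_le:
  "measure (environment_law M p) (bad n u) \<le> 4 * measure (environment_law M p) (Cross (100 * n) n)"
proof -
  interpret prob_space "environment_law M p" by (rule prob_space_environment_law)
  have "prob ((\<lambda>\<omega>. \<omega> \<circ> tile_frame n u c) -` Cross (100 * n) n) = prob (Cross (100 * n) n)" for c
  proof -
    have "prob (Cross (100 * n) n) = measure (distr (environment_law M p) (environment_law M p)
        (\<lambda>\<omega>. \<omega> \<circ> tile_frame n u c)) (Cross (100 * n) n)"
      by (simp add: distr_environment_law inj_tile_frame site_law_tile_frame)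
    also have "\<dots> = prob ((\<lambda>\<omega>. \<omega> \<circ> tile_frame n u c) -` Cross (100 * n) n)"
      by (subst measure_distr) (simp_all add: measurable_reindex site_law_tile_frame measurable_Cross)
    finally show ?thesis by simp
  qed
  moreover have "prob (bad n u) \<le> (\<Sum>c\<in>UNIV. prob ((\<lambda>\<omega>. \<omega> \<circ> tile_frame n u c) -` Cross (100 * n) n))"
    unfolding bad_eq
    by (rule finite_measure_subadditive_finite) (auto simp: UNIV_direction measurable_bad_part)
  ultimately show ?thesis by (simp add: UNIV_direction)
qed

section \<open>Locality and independence of bad tiles\<close>

text \<open>The rule is applied only at the end vertices of edges other than the last, that is, at
  intermediate vertices.\<close>

lemma Cross_cong:
  assumes "\<And>v. v \<in> rectangle m h \<Longrightarrow> \<omega> v = \<omega>' v" and "\<omega> \<in> Cross m h"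
  shows "\<omega>' \<in> Cross m h"
proof -
  obtain i j es where ij: "i \<in> {1..m}" "j \<in> {1..m}" and es: "trajectory_segment \<omega> es"
    "hd es = ((i, 0), (i, 1))" "last es = ((j, h), (j, h + 1))"
    "intermediate_vertices es \<subseteq> rectangle m h"
    using assms(2) unfolding Cross_def Cross_between_def by blast
  have "follows \<omega>' (es ! l) (es ! Suc l)" if "Suc l < length es" for l
  proof -
    have "es ! l \<in> set (butlast es)"
      using that by (metis Suc_lessD length_butlast less_diff_conv nth_butlast nth_mem Suc_eq_plus1)
    then have "snd (es ! l) \<in> intermediate_vertices es" by (simp add: intermediate_vertices_def)
    with es(4) have "\<omega> (snd (es ! l)) = \<omega>' (snd (es ! l))" by (blast intro: assms(1))
    moreover have "follows \<omega> (es ! l) (es ! Suc l)"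
      using es(1) that by (simp add: trajectory_segment_def successively_conv_nth)
    ultimately show ?thesis by (simp add: follows_def)
  qed
  then have "trajectory_segment \<omega>' es"
    using es(1) by (simp add: trajectory_segment_def successively_conv_nth)
  then show ?thesis using ij es unfolding Cross_def Cross_between_def by blast
qed

text \<open>Radius \<open>50 * n\<close>, not \<open>49 * n\<close>: the strips have length
  \<open>100 * n\<close> and stick out of the box that the trajectory leaves.\<close>

definition tile_box :: "int \<Rightarrow> vertex \<Rightarrow> vertex set" where
  "tile_box n u = {v. sup_dist v (centre n u) \<le> 50 * n}"

lemma tile_frame_rectangle:
  assumes "v \<in> rectangle (100 * n) n"
  shows "tile_frame n u c v \<in> tile_box n u"
  using assms
  by (cases v; cases c) (auto simp: rectangle_def tile_frame_def frame_def tile_box_def sup_dist_le_iff)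

lemma bad_cong:
  assumes "\<And>v. v \<in> tile_box n u \<Longrightarrow> \<omega> v = \<omega>' v" and "\<omega> \<in> bad n u"
  shows "\<omega>' \<in> bad n u"
proof -
  obtain c where c: "\<omega> \<circ> tile_frame n u c \<in> Cross (100 * n) n"
    using assms(2) by (auto simp: bad_def)
  have "\<omega>' \<circ> tile_frame n u c \<in> Cross (100 * n) n"
    by (rule Cross_cong[OF _ c]) (simp add: assms(1) tile_frame_rectangle)
  then show ?thesis by (auto simp: bad_def)
qed

text \<open>The centres are at least \<open>192 * n\<close> apart, more than the sum
  \<open>100 * n\<close> of the radii.\<close>

lemma disjoint_tile_box:
  assumes "0 < n" "2 \<le> sup_dist u v"
  shows "tile_box n u \<inter> tile_box n v = {}"
proof -
  have "96 * n * 2 \<le> 96 * n * sup_dist u v"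
    using assms by (intro mult_left_mono) auto
  then have far: "100 * n < sup_dist (centre n u) (centre n v)"
    using sup_dist_centre[OF assms(1), of u v] assms(1) by linarith
  have False if "w \<in> tile_box n u" "w \<in> tile_box n v" for w
    using far that sup_dist_triangle[of "centre n u" "centre n v" w] sup_dist_commute[of w]
    by (simp add: tile_box_def)
  then show ?thesis by blast
qed

text \<open>Restrictions of a product to disjoint coordinate sets are independent. That
  \<open>E j\<close> depends on \<open>A j\<close> alone is expressed by \<open>cong\<close>; to
  make it an event of the restricted product, the coordinates outside \<open>A j\<close> are filled
  in from a fixed point.\<close>

lemma prob_INT_PiM_disjoint:
  fixes N :: "'i \<Rightarrow> 'a measure"
  assumes N: "\<And>i. prob_space (N i)"
    and J: "finite J" "J \<noteq> {}" and disj: "disjoint_family_on A J"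
    and E: "\<And>j. j \<in> J \<Longrightarrow> E j \<in> sets (PiM UNIV N)"
    and cong: "\<And>j \<omega> \<omega>'. j \<in> J \<Longrightarrow> (\<And>i. i \<in> A j \<Longrightarrow> \<omega> i = \<omega>' i) \<Longrightarrow> \<omega> \<in> E j \<Longrightarrow>
      \<omega>' \<in> space (PiM UNIV N) \<Longrightarrow> \<omega>' \<in> E j"
  shows "measure (PiM UNIV N) (\<Inter>j\<in>J. E j) = (\<Prod>j\<in>J. measure (PiM UNIV N) (E j))"
proof -
  interpret P: prob_space "PiM UNIV N" by (intro prob_space_PiM N)
  obtain a where a: "a \<in> space (PiM UNIV N)" using P.not_empty by blast
  \<comment> \<open>The joint law of the coordinates is the product measure itself, hence the
    product of the marginals.\<close>
  have "P.indep_vars N (\<lambda>i \<omega>. \<omega> i) UNIV"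
    by (subst P.indep_vars_iff_distr_eq_PiM')
      (simp_all add: distr_PiM_component N distr_id2 restrict_UNIV flip: id_def cong: distr_cong)
  then have ind: "P.indep_vars (\<lambda>j. PiM (A j) N) (\<lambda>j \<omega>. restrict \<omega> (A j)) J"
    using P.indep_vars_restrict[of N "\<lambda>i \<omega>. \<omega> i" UNIV J A] disj by simp
  define extend where "extend j \<eta> i = (if i \<in> A j then \<eta> i else a i)" for j and \<eta> :: "'i \<Rightarrow> 'a" and i
  have meas: "extend j \<in> measurable (PiM (A j) N) (PiM UNIV N)" for j
  proof (rule measurable_PiM_single')
    show "(\<lambda>\<eta>. extend j \<eta> i) \<in> measurable (PiM (A j) N) (N i)" for i
      using a by (cases "i \<in> A j")
        (auto simp: extend_def space_PiM PiE_iff intro: measurable_component_singleton)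
    show "extend j \<in> space (Pi\<^sub>M (A j) N) \<rightarrow> (\<Pi>\<^sub>E i\<in>UNIV. space (N i))"
      using a by (auto simp: extend_def space_PiM PiE_iff)
  qed
  define F where "F j = extend j -` E j \<inter> space (PiM (A j) N)" for j
  have F: "F j \<in> sets (PiM (A j) N)" if "j \<in> J" for j
    unfolding F_def by (rule measurable_sets[OF meas E[OF that]])
  \<comment> \<open>Replacing the outside coordinates by those of \<open>a\<close> does not affect
    \<open>E j\<close>, by \<open>cong\<close> in both directions.\<close>
  have eq: "(\<lambda>\<omega>. restrict \<omega> (A j)) -` F j \<inter> space (PiM UNIV N) = E j" if j: "j \<in> J" for j
  proof -
    have "extend j (restrict \<omega> (A j)) \<in> E j \<longleftrightarrow> \<omega> \<in> E j" if \<omega>: "\<omega> \<in> space (PiM UNIV N)" for \<omega>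
    proof
      assume "extend j (restrict \<omega> (A j)) \<in> E j"
      then show "\<omega> \<in> E j"
        by (rule cong[OF j, rotated]) (auto simp: extend_def \<omega>)
    next
      assume "\<omega> \<in> E j"
      then show "extend j (restrict \<omega> (A j)) \<in> E j"
        by (rule cong[OF j, rotated]) (use a \<omega> in \<open>auto simp: extend_def space_PiM PiE_iff\<close>)
    qed
    moreover have "restrict \<omega> (A j) \<in> space (PiM (A j) N)" if "\<omega> \<in> space (PiM UNIV N)" for \<omega>
      using that by (auto simp: space_PiM PiE_iff)
    ultimately show ?thesis using sets.sets_into_space[OF E[OF j]] by (auto simp: F_def)
  qed
  show ?thesis using P.indep_varsD_finite[OF ind J(2,1) F] by (simp add: eq)
qed

lemma measure_bad_walk:
  assumes n: "0 < n" and us: "sorted_wrt (\<lambda>u v. 2 \<le> sup_dist u v) us"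
  shows "measure (environment_law M p) (\<Inter>u\<in>set us. bad n u)
    \<le> (4 * measure (environment_law M p) (Cross (100 * n) n)) ^ length us"
proof (cases "us = []")
  \<comment> \<open>The empty intersection is handled apart, as the independence lemma takes a
    nonempty index set.\<close>
  case True
  interpret prob_space "environment_law M p" by (rule prob_space_environment_law)
  show ?thesis using True by simp
next
  case False
  have sep: "2 \<le> sup_dist (us ! i) (us ! j)" if "i \<noteq> j" "i < length us" "j < length us" for i j
    using that us sorted_wrt_nth_less[OF us] by (metis linorder_neqE_nat sup_dist_commute)
  \<comment> \<open>No tile repeats, so the product over \<open>set us\<close> has
    \<open>length us\<close> factors.\<close>
  have "distinct us"
    using sep unfolding distinct_conv_nth by (metis sup_dist_self not_numeral_le_zero)
  then have card: "card (set us) = length us" by (rule distinct_card)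
  have "disjoint_family_on (tile_box n) (set us)"
    unfolding disjoint_family_on_def using disjoint_tile_box[OF n] sep by (metis in_set_conv_nth)
  then have "measure (environment_law M p) (\<Inter>u\<in>set us. bad n u)
      = (\<Prod>u\<in>set us. measure (environment_law M p) (bad n u))"
    unfolding environment_law_def
  proof (intro prob_INT_PiM_disjoint[where A = "tile_box n"])
    show "bad n u \<in> sets (\<Pi>\<^sub>M v\<in>UNIV. measure_pmf (site_law M p v))" for u
      using measurable_bad unfolding environment_law_def .
    show "\<omega>' \<in> bad n u" if "\<And>v. v \<in> tile_box n u \<Longrightarrow> \<omega> v = \<omega>' v" "\<omega> \<in> bad n u" for u \<omega> \<omega>'
      by (rule bad_cong[OF that])
  qed (use False in \<open>simp_all add: prob_space_measure_pmf\<close>)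
  also have "\<dots> \<le> (\<Prod>u\<in>set us. 4 * measure (environment_law M p) (Cross (100 * n) n))"
    by (intro prod_mono) (simp add: measure_bad_le)
  finally show ?thesis by (simp add: card)
qed

section \<open>Union bound and choice of constants\<close>

lemma measure_PlaneLoc_ge:
  assumes n: "0 < n" and N: "2 * real N \<le> m / (96 * n) - 1 / 2"
  shows "measure (environment_law M p) (PlaneLoc m)
    \<ge> 1 - (100 * measure (environment_law M p) (Cross (100 * n) n)) ^ N"
proof -
  interpret prob_space "environment_law M p" by (rule prob_space_environment_law)
  let ?W = "{us \<in> walks N 0. sorted_wrt (\<lambda>u v. 2 \<le> sup_dist u v) us}"
  let ?q = "4 * prob (Cross (100 * n) n)"
  have W: "finite ?W" "card ?W \<le> 25 ^ N"
    using card_walks[of N 0] card_mono[of "walks N 0" ?W] by auto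
  have meas: "(\<Inter>u\<in>set us. bad n u) \<in> events" for us
    by (cases "us = []") (use sets.top[of "environment_law M p"] in \<open>auto intro: measurable_bad\<close>)
  have "- PlaneLoc m \<subseteq> (\<Union>us\<in>?W. \<Inter>u\<in>set us. bad n u)"
  proof
    fix \<omega> assume "\<omega> \<in> - PlaneLoc m"
    then obtain e where "trajectory \<omega> e" "fst (e 0) \<in> square 1" "\<not> remains_in e (square m)"
      by (auto simp: PlaneLoc_def)
    then show "\<omega> \<in> (\<Union>us\<in>?W. \<Inter>u\<in>set us. bad n u)"
      using escape_imp_bad_walk[OF _ n _ _ N] by fast
  qed
  then have "prob (- PlaneLoc m) \<le> prob (\<Union>us\<in>?W. \<Inter>u\<in>set us. bad n u)"
    by (intro finite_measure_mono sets.finite_UN W meas)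
  also have "\<dots> \<le> (\<Sum>us\<in>?W. prob (\<Inter>u\<in>set us. bad n u))"
    by (intro finite_measure_subadditive_finite W) (auto simp: meas)
  also have "\<dots> \<le> (\<Sum>us\<in>?W. ?q ^ N)"
  proof (intro sum_mono)
    fix us assume "us \<in> ?W"
    then show "prob (\<Inter>u\<in>set us. bad n u) \<le> ?q ^ N"
      using measure_bad_walk[OF n, of us M p] by (auto simp: walks_def)
  qed
  also have "\<dots> \<le> 25 ^ N * ?q ^ N"
  proof -
    have "real (card ?W) \<le> 25 ^ N" using of_nat_mono[OF W(2), where 'a = real] by simp
    then show ?thesis by (simp add: mult_right_mono)
  qed
  also have "\<dots> = (100 * prob (Cross (100 * n) n)) ^ N"
    by (subst power_mult_distrib[symmetric]) simp
  finally show ?thesis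
    using prob_compl[OF measurable_PlaneLoc[of m M p]] by (simp add: Compl_eq_Diff_UNIV)
qed

theorem proposition1p3:
  shows "\<exists>c\<^sub>0 c C :: real. c\<^sub>0 > 0 \<and> c > 0 \<and> C > 0 \<and>
    (\<forall>(M :: model) (p :: real) (n\<^sub>0 :: int).
       0 < p \<longrightarrow> p < 1 \<longrightarrow> n\<^sub>0 > 100 \<longrightarrow>
       measure (environment_law M p) (Cross (100 * n\<^sub>0) n\<^sub>0) \<le> c\<^sub>0 \<longrightarrow>
       (\<forall>m :: real. m \<ge> C * real_of_int n\<^sub>0 \<longrightarrow>
          measure (environment_law M p) (PlaneLoc m) \<ge> 1 - exp (- (c * m / real_of_int n\<^sub>0))))"
proof -
  have "1 - exp (- (1 / 400 * m / real_of_int n)) \<le> measure (environment_law M p) (PlaneLoc m)"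
    if n: "n > 100" and small: "measure (environment_law M p) (Cross (100 * n) n) \<le> 1 / 300"
      and m: "m \<ge> 1000 * real_of_int n" for M p and n :: int and m :: real
  proof -
    let ?q = "100 * measure (environment_law M p) (Cross (100 * n) n)"
    define r where "r = m / real_of_int n"
    have r: "r \<ge> 1000" using m n by (simp add: r_def field_simps)
    \<comment> \<open>The largest \<open>N\<close> with \<open>2 * N \<le> r / 96 - 1 / 2\<close>,
      as \<open>measure_PlaneLoc_ge\<close> demands.\<close>
    define N where "N = nat \<lfloor>r / 192 - 1 / 4\<rfloor>"
    have N: "real N \<le> r / 192 - 1 / 4" "r / 192 - 5 / 4 \<le> real N"
      using r unfolding N_def by linarith+
    have "?q \<le> exp (- 1)"
    proof -
      \<comment> \<open>The threshold \<open>1 / 300\<close> comes from here: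
        \<open>100 / 300 = 1 / 3 \<le> exp (- 1)\<close>, because e is at most 3.\<close>
      have "1 / 3 \<le> exp (- 1 :: real)" using exp_le by (simp add: exp_minus field_simps)
      with small show ?thesis by linarith
    qed
    then have "?q ^ N \<le> exp (- 1) ^ N" by (intro power_mono) auto
    also have "\<dots> = exp (- real N)" by (simp flip: exp_of_nat_mult)
    \<comment> \<open>The rate \<open>1 / 400\<close> is below \<open>1 / 192\<close>, and for
      \<open>r \<ge> 1000\<close> the difference absorbs the loss of \<open>5 / 4\<close>.\<close>
    also have "\<dots> \<le> exp (- (1 / 400 * r))" using N(2) r by simp
    finally have "?q ^ N \<le> exp (- (1 / 400 * m / real_of_int n))" by (simp add: r_def)
    moreover have "2 * real N \<le> m / (96 * n) - 1 / 2"
      using N(1) by (simp add: r_def field_simps)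
    ultimately show ?thesis
      using measure_PlaneLoc_ge[of n N m M p] n by linarith
  qed
  then show ?thesis
    by (intro exI[of _ "1 / 300"] exI[of _ "1 / 400"] exI[of _ 1000]) simp
qed

end
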